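(* For each integer $r\ge2$ and each positive integer $m$, there is, up to row and column permutations, a unique simple $m$-rowed $r$-matrix $A$ that avoids $I_2$ and has $|A|=\operatorname{forb}(m,r,I_2)$.
   Context: An $r$-matrix is a matrix with entries in $\{0,1,\dots,r-1\}$. A matrix is simple if it has no repeated columns. $I_2$ is the $2\times2$ identity matrix; $A$ avoids $I_2$ if no submatrix of $A$ is a row and column permutation of $I_2$. $|A|$ is the number of columns of $A$, and $\operatorname{forb}(m,r,I_2)$ is the maximum number of columns of a simple $m$-rowed $r$-matrix avoiding $I_2$. *)

theory Defs
  imports
    "Jordan_Normal_Form.DL_Submatrix"
    "HOL-Combinatorics.Permutations"
begin

definition r_matrix :: "nat \<Rightarrow> nat mat \<Rightarrow> bool" where
  "r_matrix r A \<longleftrightarrow> elements_mat A \<subseteq> {0..<r}"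

definition simple_matrix :: "'a mat \<Rightarrow> bool" where
  "simple_matrix A \<longleftrightarrow> distinct (cols A)"

definition row_col_permutation :: "'a mat \<Rightarrow> 'a mat \<Rightarrow> bool" where
  "row_col_permutation A B \<longleftrightarrow>
     dim_row A = dim_row B \<and> dim_col A = dim_col B \<and>
     (\<exists>p q. p permutes {..<dim_row B} \<and> q permutes {..<dim_col B} \<and>
        A = mat (dim_row B) (dim_col B) (\<lambda>(i, j). B $$ (p i, q j)))"

definition avoids :: "'a mat \<Rightarrow> 'a mat \<Rightarrow> bool" where
  "avoids A F \<longleftrightarrow> \<not> (\<exists>I J. row_col_permutation (submatrix A I J) F)"

definition avoiding_matrices :: "nat \<Rightarrow> nat \<Rightarrow> nat mat \<Rightarrow> nat mat set" where
  "avoiding_matrices m r F =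
     {A. dim_row A = m \<and> r_matrix r A \<and> simple_matrix A \<and> avoids A F}"

(* A simple m-rowed r-matrix has at most r ^ m columns, so the set below is finite. *)
definition forb :: "nat \<Rightarrow> nat \<Rightarrow> nat mat \<Rightarrow> nat" where
  "forb m r F = Max (dim_col ` avoiding_matrices m r F)"

abbreviation I\<^sub>2 :: "nat mat" where
  "I\<^sub>2 \<equiv> 1\<^sub>m 2"

end

theory Submission
  imports Defs
begin

text \<open>
  Sort the entries 0 and 1 of a column, keeping all larger entries in place, so that every 1
  precedes every 0. Two columns with the same sorted form have 0/1 entries in the same places and
  equally many 1s; if they differ, they contain \<open>I\<^sub>2\<close>. So sorting is injective on the columns of an
  \<open>I\<^sub>2\<close>-avoiding matrix, and the set of sorted columns, which itself avoids \<open>I\<^sub>2\<close>, is extremal.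
  If equality holds, then every column \<open>1\<^sup>k 0\<^sup>m\<^sup>-\<^sup>k\<close> is the sorted form of a column, and the supports
  of these columns form a full chain. The chain orders the rows, and any column
  that is not sorted in this order contains \<open>I\<^sub>2\<close> together with a member of the chain.
\<close>

text \<open>The four equations force \<open>c\<close> and \<open>d\<close>, and \<open>i\<close> and
  \<open>j\<close>, to differ. Since \<open>i\<close> and \<open>j\<close> come in either order,
  this excludes every row and column permutation of \<open>I\<^sub>2\<close>.\<close>

definition I2_free :: "nat \<Rightarrow> nat vec set \<Rightarrow> bool" where
  "I2_free m F \<longleftrightarrow> (\<forall>c\<in>F. \<forall>d\<in>F. \<forall>i<m. \<forall>j<m.
     \<not> (c $ i = 1 \<and> c $ j = 0 \<and> d $ i = 0 \<and> d $ j = 1))"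

definition r_vecs :: "nat \<Rightarrow> nat \<Rightarrow> nat vec set" where
  "r_vecs m r = {c \<in> carrier_vec m. \<forall>i<m. c $ i < r}"

definition sorted_vecs :: "nat \<Rightarrow> nat \<Rightarrow> nat vec set" where
  "sorted_vecs m r = {c \<in> r_vecs m r. \<forall>j<m. \<forall>i<j. \<not> (c $ i = 0 \<and> c $ j = 1)}"

definition bits :: "nat vec \<Rightarrow> nat set" where
  "bits c = {i. i < dim_vec c \<and> c $ i \<le> 1}"

definition ones :: "nat vec \<Rightarrow> nat set" where
  "ones c = {i. i < dim_vec c \<and> c $ i = 1}"

text \<open>The inner cardinality is the rank of \<open>i\<close>, counted from 0, among the 0/1
  positions; the first \<open>card (ones c)\<close> of these positions receive a 1.\<close>

definition sort_bits :: "nat vec \<Rightarrow> nat vec" where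
  "sort_bits c = vec (dim_vec c) (\<lambda>i. if i \<in> bits c
     then (if card {j \<in> bits c. j < i} < card (ones c) then 1 else 0) else c $ i)"

section \<open>Sorting the 0/1 entries\<close>

lemma finite_bits [simp]: "finite (bits c)"
  by (simp add: bits_def)

lemma finite_ones [simp]: "finite (ones c)"
  by (simp add: ones_def)

lemma ones_subset_bits: "ones c \<subseteq> bits c"
  by (auto simp: ones_def bits_def)

text \<open>The rank function is strictly increasing on \<open>S\<close>, hence a bijection onto
  \<open>{..<card S}\<close>; the set counted here is the preimage of \<open>{..<k}\<close>.\<close>

lemma card_rank_less:
  fixes S :: "nat set"
  assumes "finite S" "k \<le> card S"
  shows "card {i \<in> S. card {j \<in> S. j < i} < k} = k"
proof -
  define rank where "rank i = card {j \<in> S. j < i}" for i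
  have less: "rank i < rank i'" if "i \<in> S" "i < i'" for i i'
    unfolding rank_def by (rule psubset_card_mono) (use that assms in auto)
  have inj: "inj_on rank S"
    by (rule inj_onI) (metis less less_irrefl linorder_neqE_nat)
  have "rank ` S \<subseteq> {..<card S}"
    unfolding rank_def using assms(1) by (auto intro!: psubset_card_mono)
  then have img: "rank ` S = {..<card S}"
    by (intro card_subset_eq) (simp_all add: card_image inj)
  have "rank ` {i \<in> S. rank i < k} = {..<k}"
    using img assms(2) by (auto simp: image_iff set_eq_iff) (metis less_le_trans)
  moreover have "inj_on rank {i \<in> S. rank i < k}"
    by (rule inj_on_subset[OF inj]) auto
  ultimately show ?thesis
    unfolding rank_def[symmetric] by (metis card_image card_lessThan)
qed

lemma dim_sort_bits [simp]: "dim_vec (sort_bits c) = dim_vec c"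
  by (simp add: sort_bits_def)

lemma sort_bits_index:
  assumes "i < dim_vec c"
  shows "sort_bits c $ i = 1 \<longleftrightarrow> i \<in> bits c \<and> card {j \<in> bits c. j < i} < card (ones c)"
    and "sort_bits c $ i = 0 \<longleftrightarrow> i \<in> bits c \<and> card (ones c) \<le> card {j \<in> bits c. j < i}"
proof -
  have "i \<in> bits c \<or> c $ i > 1"
    using assms by (auto simp: bits_def)
  then show "sort_bits c $ i = 1 \<longleftrightarrow> i \<in> bits c \<and> card {j \<in> bits c. j < i} < card (ones c)"
    and "sort_bits c $ i = 0 \<longleftrightarrow> i \<in> bits c \<and> card (ones c) \<le> card {j \<in> bits c. j < i}"
    using assms by (auto simp: sort_bits_def)
qed

lemma bits_sort_bits [simp]: "bits (sort_bits c) = bits c"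
proof -
  have "sort_bits c $ i \<le> 1 \<longleftrightarrow> c $ i \<le> 1" if "i < dim_vec c" for i
    using that by (cases "i \<in> bits c") (simp_all add: sort_bits_def, simp_all add: bits_def)
  then show ?thesis
    by (auto simp: bits_def)
qed

lemma card_ones_sort_bits [simp]: "card (ones (sort_bits c)) = card (ones c)"
proof -
  have "ones (sort_bits c) = {i \<in> bits c. card {j \<in> bits c. j < i} < card (ones c)}"
    using sort_bits_index(1)[of _ c] unfolding ones_def[of "sort_bits c"]
    by (auto simp: bits_def[of c])
  then show ?thesis
    by (simp add: card_rank_less card_mono ones_subset_bits)
qed

lemma sort_bits_in_sorted_vecs:
  assumes "c \<in> r_vecs m r" "r \<ge> 2"
  shows "sort_bits c \<in> sorted_vecs m r"
proof -
  have dim: "dim_vec c = m" and lt: "\<And>i. i < m \<Longrightarrow> c $ i < r"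
    using assms(1) by (auto simp: r_vecs_def)
  have "\<not> (sort_bits c $ i = 0 \<and> sort_bits c $ j = 1)" if "i < j" "j < m" for i j
  proof
    assume *: "sort_bits c $ i = 0 \<and> sort_bits c $ j = 1"
    then have "card (ones c) \<le> card {l \<in> bits c. l < i}"
      "card {l \<in> bits c. l < j} < card (ones c)"
      using that dim sort_bits_index(1)[of j c] sort_bits_index(2)[of i c] by simp_all
    moreover have "card {l \<in> bits c. l < i} \<le> card {l \<in> bits c. l < j}"
      by (rule card_mono) (use that in auto)
    ultimately show False by simp
  qed
  moreover have "sort_bits c \<in> r_vecs m r"
  proof -
    have "sort_bits c $ i < r" if "i < m" for i
      using that lt[OF that] dim assms(2) by (simp add: sort_bits_def)
    moreover have "sort_bits c \<in> carrier_vec m"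
      by (rule carrier_vecI) (simp add: dim)
    ultimately show ?thesis
      unfolding r_vecs_def by blast
  qed
  ultimately show ?thesis
    by (auto simp: sorted_vecs_def)
qed

text \<open>A row in \<open>ones c - ones d\<close> would, by the cardinalities, come with a row in
  \<open>ones d - ones c\<close>. As the 0/1 positions agree, the missing 1s are 0s, and the two
  rows exhibit \<open>I\<^sub>2\<close>.\<close>

lemma I2_free_ones_subset:
  assumes "I2_free m F" "c \<in> F" "d \<in> F" "dim_vec c = m" "dim_vec d = m"
    and "bits c = bits d" "card (ones c) \<le> card (ones d)"
  shows "ones c \<subseteq> ones d"
proof (rule ccontr)
  assume "\<not> ones c \<subseteq> ones d"
  then obtain i where i: "i \<in> ones c" "i \<notin> ones d" by blast
  have "\<not> ones d \<subseteq> ones c"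
    using i assms(7) by (metis card_seteq finite_ones)
  then obtain j where j: "j \<in> ones d" "j \<notin> ones c" by blast
  have "i \<in> bits d" "j \<in> bits c"
    using i j assms(6) ones_subset_bits by blast+
  then have "c $ i = 1" "c $ j = 0" "d $ i = 0" "d $ j = 1" "i < m" "j < m"
    using i j assms(4,5) by (auto simp: ones_def bits_def)
  then show False
    using assms(1-3) unfolding I2_free_def by blast
qed

text \<open>Sorting keeps the 0/1 positions, the number of 1s and all larger entries. The places of
  the 1s are recovered by the preceding inclusion, used in both directions.\<close>

lemma sort_bits_inj_on:
  assumes "I2_free m F" "F \<subseteq> carrier_vec m"
  shows "inj_on sort_bits F"
proof (rule inj_onI)
  fix c d assume cd: "c \<in> F" "d \<in> F" and eq: "sort_bits c = sort_bits d"
  have dim: "dim_vec c = m" "dim_vec d = m"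
    using cd assms(2) by auto
  have b: "bits c = bits d"
    by (metis bits_sort_bits eq)
  have o: "card (ones c) = card (ones d)"
    by (metis card_ones_sort_bits eq)
  have "ones c = ones d"
    using I2_free_ones_subset[OF assms(1)] cd dim b o by (metis order_refl subset_antisym)
  show "c = d"
  proof (rule eq_vecI)
    fix i assume "i < dim_vec d"
    then have i: "i < m" using dim by simp
    show "c $ i = d $ i"
    proof (cases "i \<in> bits c")
      case True
      moreover have "i \<in> bits d" using True b by simp
      moreover have "i \<in> ones c \<longleftrightarrow> i \<in> ones d" using \<open>ones c = ones d\<close> by simp
      ultimately show ?thesis
        by (auto simp: bits_def ones_def)
    next
      case False
      moreover have "sort_bits c $ i = sort_bits d $ i" using eq by simp
      ultimately show ?thesis using i dim b by (simp add: sort_bits_def)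
    qed
  qed (simp add: dim)
qed

section \<open>The upper bound for families that avoid \<open>I\<^sub>2\<close>\<close>

lemma finite_r_vecs: "finite (r_vecs m r)"
proof (rule finite_subset)
  show "r_vecs m r \<subseteq> vec m ` ({..<m} \<rightarrow>\<^sub>E {..<r})"
  proof
    fix c assume c: "c \<in> r_vecs m r"
    then have "c = vec m (restrict (\<lambda>i. c $ i) {..<m})"
      by (intro eq_vecI) (auto simp: r_vecs_def)
    moreover have "restrict (\<lambda>i. c $ i) {..<m} \<in> {..<m} \<rightarrow>\<^sub>E {..<r}"
      using c by (auto simp: r_vecs_def)
    ultimately show "c \<in> vec m ` ({..<m} \<rightarrow>\<^sub>E {..<r})" by blast
  qed
qed (intro finite_imageI finite_PiE, auto)

lemma finite_sorted_vecs: "finite (sorted_vecs m r)"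
  using finite_r_vecs by (auto simp: sorted_vecs_def intro: finite_subset)

text \<open>In a forbidden pattern, sortedness of \<open>c\<close> would force \<open>i < j\<close>
  and sortedness of \<open>d\<close> would force \<open>j < i\<close>.\<close>

lemma I2_free_sorted_vecs: "I2_free m (sorted_vecs m r)"
  unfolding I2_free_def
proof (intro ballI allI impI notI)
  fix c d i j assume cd: "c \<in> sorted_vecs m r" "d \<in> sorted_vecs m r" and ij: "i < m" "j < m"
    and e: "c $ i = 1 \<and> c $ j = 0 \<and> d $ i = 0 \<and> d $ j = 1"
  have sorted: "\<not> (v $ k = 0 \<and> v $ l = 1)" if "v \<in> sorted_vecs m r" "k < l" "l < m" for v k l
    using that by (simp add: sorted_vecs_def)
  show False
    using sorted[OF cd(1), of j i] sorted[OF cd(2), of i j] ij e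
    by (cases i j rule: linorder_cases) auto
qed

lemma card_I2_free_le:
  assumes "I2_free m F" "F \<subseteq> r_vecs m r" "r \<ge> 2"
  shows "card F \<le> card (sorted_vecs m r)"
proof (rule card_inj_on_le)
  show "inj_on sort_bits F"
    using sort_bits_inj_on[OF assms(1)] assms(2) by (auto simp: r_vecs_def)
qed (use assms sort_bits_in_sorted_vecs finite_sorted_vecs in auto)

section \<open>Extremal families\<close>

text \<open>Equal cardinalities make the injection \<open>sort_bits\<close> surjective, so the 0/1
  vector \<open>t\<close> with \<open>k\<close> leading 1s has a preimage in \<open>F\<close>, with
  the same 0/1 positions and number of 1s.\<close>

lemma extremal_I2_free_chain:
  assumes "I2_free m F" "F \<subseteq> r_vecs m r" "r \<ge> 2" "card F = card (sorted_vecs m r)"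
    and "k \<le> m"
  shows "\<exists>c\<in>F. bits c = {..<m} \<and> card (ones c) = k"
proof -
  have inj: "inj_on sort_bits F"
    using sort_bits_inj_on[OF assms(1)] assms(2) by (auto simp: r_vecs_def)
  have "sort_bits ` F = sorted_vecs m r"
    using assms sort_bits_in_sorted_vecs
    by (intro card_subset_eq finite_sorted_vecs) (auto simp: card_image inj)
  moreover define t :: "nat vec" where "t = vec m (\<lambda>i. if i < k then 1 else 0)"
  moreover have "t \<in> sorted_vecs m r"
    using assms(3) by (auto simp: t_def sorted_vecs_def r_vecs_def)
  ultimately obtain c where c: "c \<in> F" "sort_bits c = t" by (metis imageE)
  have "bits t = {..<m}" "ones t = {..<k}"
    using assms(5) by (auto simp: t_def bits_def ones_def split: if_splits)
  then show ?thesis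
    using c by (metis bits_sort_bits card_lessThan card_ones_sort_bits)
qed

lemma extremal_I2_free_sorted:
  assumes F: "I2_free m F" "F \<subseteq> r_vecs m r" and r: "r \<ge> 2"
    and card: "card F = card (sorted_vecs m r)"
  obtains p where "p permutes {..<m}" "(\<lambda>c. vec m (\<lambda>i. c $ p i)) ` F = sorted_vecs m r"
proof -
  obtain C where C: "\<And>k. k \<le> m \<Longrightarrow> C k \<in> F" "\<And>k. k \<le> m \<Longrightarrow> bits (C k) = {..<m}"
    "\<And>k. k \<le> m \<Longrightarrow> card (ones (C k)) = k"
    using extremal_I2_free_chain[OF F r card] by metis
  have dim: "dim_vec c = m" if "c \<in> F" for c
    using that F(2) by (auto simp: r_vecs_def)
  have mono: "ones (C k) \<subseteq> ones (C l)" if "k \<le> l" "l \<le> m" for k l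
    using that C dim by (intro I2_free_ones_subset[OF F(1)]) auto
  have "\<exists>i. i \<in> ones (C (Suc k)) - ones (C k)" if "k < m" for k
  proof -
    have "\<not> ones (C (Suc k)) \<subseteq> ones (C k)"
      using card_mono[of "ones (C k)" "ones (C (Suc k))"] C(3)[of k] C(3)[of "Suc k"] that
      by auto
    then show ?thesis by blast
  qed
  \<comment> \<open>Successive supports in the chain differ in size by one, so \<open>p0 k\<close>
    is the row that enters at step \<open>k\<close>; this is the new row order.\<close>
  then obtain p0 where p0: "\<And>k. k < m \<Longrightarrow> p0 k \<in> ones (C (Suc k)) - ones (C k)" by metis
  have p0_notin: "p0 j \<notin> ones (C (Suc i))" if "i < j" "j < m" for i j
    using mono[of "Suc i" j] p0[of j] that by auto
  have p0_lt: "p0 i < m" if "i < m" for i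
    using p0[OF that] C(1)[of "Suc i"] dim that by (auto simp: ones_def)
  have "inj_on p0 {..<m}"
  proof (rule linorder_inj_onI)
    fix i j assume "i < j" "i \<in> {..<m}" "j \<in> {..<m}"
    then show "p0 i \<noteq> p0 j"
      using p0[of i] p0_notin[of i j] by auto
  qed auto
  then have "bij_betw p0 {..<m} {..<m}"
    using p0_lt by (intro bij_betw_imageI endo_inj_surj) auto
  \<comment> \<open>Nothing is known about \<open>p0\<close> from \<open>m\<close> on, whereas
    \<open>permutes\<close> demands the identity there.\<close>
  define p where "p i = (if i < m then p0 i else i)" for i
  have "bij_betw p {..<m} {..<m}"
    using \<open>bij_betw p0 {..<m} {..<m}\<close> by (rule bij_betw_cong[THEN iffD1, rotated]) (simp add: p_def)
  then have p: "p permutes {..<m}"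
    by (rule bij_imp_permutes) (simp add: p_def)
  let ?f = "\<lambda>c. vec m (\<lambda>i. c $ p i)"
  \<comment> \<open>If \<open>c\<close> had a 0 in row \<open>p0 i\<close> and a 1 in row
    \<open>p0 j\<close> with \<open>i < j\<close>, the chain member \<open>C (Suc i)\<close>, which
    has 1 and 0 there, would complete \<open>I\<^sub>2\<close>.\<close>
  have sub: "?f c \<in> sorted_vecs m r" if c: "c \<in> F" for c
  proof -
    have "\<not> (c $ p0 i = 0 \<and> c $ p0 j = 1)" if ij: "i < j" "j < m" for i j
    proof
      assume *: "c $ p0 i = 0 \<and> c $ p0 j = 1"
      have k: "Suc i \<le> m" using ij by simp
      have "C (Suc i) $ p0 i = 1"
        using p0[of i] ij by (auto simp: ones_def)
      moreover have "C (Suc i) $ p0 j = 0"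
      proof -
        have "p0 j \<in> bits (C (Suc i))"
          using C(2)[OF k] p0_lt[OF ij(2)] by simp
        then show ?thesis
          using p0_notin[OF ij] by (auto simp: ones_def bits_def)
      qed
      ultimately show False
        using F(1)[unfolded I2_free_def, rule_format, OF C(1)[OF k] c, of "p0 i" "p0 j"]
          * p0_lt[of i] p0_lt[of j] ij by simp
    qed
    then show ?thesis
      using F(2) c p0_lt by (fastforce simp: sorted_vecs_def r_vecs_def p_def)
  qed
  \<comment> \<open>Because \<open>p\<close> reaches every row, \<open>?f\<close> loses no entry;
    equal cardinalities then turn the inclusion \<open>sub\<close> into an equality.\<close>
  have "inj_on ?f F"
  proof (rule inj_onI)
    fix c d assume cd: "c \<in> F" "d \<in> F" "?f c = ?f d"
    show "c = d"
    proof (rule eq_vecI)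
      fix i assume "i < dim_vec d"
      then have "i < m" using cd dim by simp
      then obtain k where "k < m" "i = p k"
        using permutes_image[OF p] by (metis imageE lessThan_iff)
      then show "c $ i = d $ i"
        using arg_cong[OF cd(3), of "\<lambda>v. v $ k"] by simp
    qed (use cd dim in simp)
  qed
  then have "?f ` F = sorted_vecs m r"
    using sub card by (intro card_subset_eq finite_sorted_vecs) (auto simp: card_image)
  with p show thesis by (rule that)
qed

section \<open>Matrices and their sets of columns\<close>

lemma pick_pair:
  assumes "a < (b::nat)"
  shows "pick {a, b} 0 = a" "pick {a, b} (Suc 0) = b"
proof -
  show 0: "pick {a, b} 0 = a"
    using assms by (auto intro!: Least_equality)
  show "pick {a, b} (Suc 0) = b"
    using assms 0 by (auto intro!: Least_equality simp del: pick.simps(1))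
qed

text \<open>Here \<open>i\<close>, \<open>j\<close> are the preimages of 0, 1 under the row
  permutation, and \<open>a\<close>, \<open>b\<close> those under the column permutation.\<close>

lemma row_col_permutation_I2_iff:
  fixes M :: "nat mat"
  shows "row_col_permutation M I\<^sub>2 \<longleftrightarrow> dim_row M = 2 \<and> dim_col M = 2 \<and>
    (\<exists>i<2. \<exists>j<2. \<exists>a<2. \<exists>b<2. M $$ (i, a) = 1 \<and> M $$ (j, a) = 0 \<and> M $$ (i, b) = 0 \<and> M $$ (j, b) = 1)"
  (is "_ \<longleftrightarrow> ?R")
proof
  assume "row_col_permutation M I\<^sub>2"
  then obtain p q where pq: "p permutes {..<2}" "q permutes {..<2}"
    and M: "M = mat 2 2 (\<lambda>(i, j). I\<^sub>2 $$ (p i, q j))"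
    by (auto simp: row_col_permutation_def)
  have "(0::nat) \<in> p ` {..<2}" "(1::nat) \<in> p ` {..<2}" "(0::nat) \<in> q ` {..<2}" "(1::nat) \<in> q ` {..<2}"
    using permutes_image[OF pq(1)] permutes_image[OF pq(2)] by simp_all
  then obtain i j a b where *: "i < 2" "j < 2" "a < 2" "b < 2" "p i = 0" "p j = 1" "q a = 0" "q b = 1"
    by (smt (verit) imageE lessThan_iff)
  then have "M $$ (i, a) = 1 \<and> M $$ (j, a) = 0 \<and> M $$ (i, b) = 0 \<and> M $$ (j, b) = 1"
    by (simp add: M)
  moreover have "dim_row M = 2" "dim_col M = 2"
    by (simp_all add: M)
  ultimately show ?R
    using * by blast
next
  assume ?R
  then obtain i j a b where M: "dim_row M = 2" "dim_col M = 2"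
    and lt: "i < 2" "j < 2" "a < 2" "b < 2"
    and ent: "M $$ (i, a) = 1" "M $$ (j, a) = 0" "M $$ (i, b) = 0" "M $$ (j, b) = 1" by blast
  \<comment> \<open>A permutation of two points is fixed by one value: this one sends
    \<open>i\<close> to 0, hence \<open>j\<close> to 1; likewise \<open>q\<close> sends
    \<open>a\<close> to 0 and \<open>b\<close> to 1.\<close>
  define p where "p = transpose 0 i"
  define q where "q = transpose 0 a"
  have "p permutes {..<2}" "q permutes {..<2}"
    using lt by (auto simp: p_def q_def intro!: permutes_swap_id)
  moreover have "M = mat 2 2 (\<lambda>(i, j). I\<^sub>2 $$ (p i, q j))"
    using M lt ent
    by (intro eq_matI) (auto simp: p_def q_def less_2_cases_iff transpose_def split: if_splits)
  ultimately show "row_col_permutation M I\<^sub>2"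
    using M by (auto simp: row_col_permutation_def)
qed

lemma avoids_I2_iff:
  fixes A :: "nat mat"
  shows "avoids A I\<^sub>2 \<longleftrightarrow> I2_free (dim_row A) (set (cols A))"
proof
  assume *: "I2_free (dim_row A) (set (cols A))"
  show "avoids A I\<^sub>2"
    unfolding avoids_def
  proof clarify
    fix I J assume "row_col_permutation (submatrix A I J) I\<^sub>2"
    then obtain i j a b where dim: "dim_row (submatrix A I J) = 2" "dim_col (submatrix A I J) = 2"
      and lt: "i < 2" "j < 2" "a < 2" "b < 2"
      and ent: "submatrix A I J $$ (i, a) = 1" "submatrix A I J $$ (j, a) = 0"
        "submatrix A I J $$ (i, b) = 0" "submatrix A I J $$ (j, b) = 1"
      unfolding row_col_permutation_I2_iff by blast
    \<comment> \<open>The map \<open>pick\<close> carries positions in the submatrix back to rows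
      and columns of \<open>A\<close>, where \<open>I2_free\<close> applies.\<close>
    have sub: "submatrix A I J $$ (i, a) = col A (pick J a) $ pick I i \<and> pick I i < dim_row A
       \<and> col A (pick J a) \<in> set (cols A)" if "i < 2" "a < 2" for i a
    proof -
      have "i < card {i. i < dim_row A \<and> i \<in> I}" "a < card {j. j < dim_col A \<and> j \<in> J}"
        using that dim by (simp_all add: dim_submatrix)
      moreover from this have "pick I i < dim_row A" "pick J a < dim_col A"
        by (simp_all add: pick_le)
      ultimately show ?thesis
        by (simp add: submatrix_index cols_def)
    qed
    show False
      using * ent sub lt unfolding I2_free_def by metis
  qed
next
  assume av: "avoids A I\<^sub>2"
  \<comment> \<open>Assuming \<open>i < j\<close> loses nothing: swapping \<open>i\<close> with
    \<open>j\<close> and \<open>a\<close> with \<open>b\<close> together preserves the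
    pattern.\<close>
  have no: False if "i < dim_row A" "j < dim_row A" "a < dim_col A" "b < dim_col A" "i < j"
    "A $$ (i, a) = 1" "A $$ (j, a) = 0" "A $$ (i, b) = 0" "A $$ (j, b) = 1" for i j a b
  proof -
    have neq: "a \<noteq> b" using that by auto
    \<comment> \<open>The columns may still come in either order; \<open>x\<close> and
      \<open>y\<close> are the positions of \<open>a\<close> and \<open>b\<close> in the increasing
      pair \<open>l\<close>, \<open>u\<close>.\<close>
    obtain l u x y where lu: "l < u" "{l, u} = {a, b}" and xy: "x < 2" "y < 2"
      and pick: "pick {l, u} x = a" "pick {l, u} y = b"
    proof (cases "a < b")
      case True
      then show ?thesis
        using that[of a b 0 "Suc 0"] pick_pair[of a b] by (simp del: pick.simps)
    next
      case False
      then have "b < a" using neq by simp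
      then show ?thesis
        using that[of b a "Suc 0" 0] pick_pair[of b a] by (simp add: insert_commute del: pick.simps)
    qed
    let ?M = "submatrix A {i, j} {l, u}"
    have cd: "{k. k < dim_row A \<and> k \<in> {i, j}} = {i, j}"
      "{k. k < dim_col A \<and> k \<in> {l, u}} = {l, u}"
      using that lu(2) by auto
    have dim: "dim_row ?M = 2" "dim_col ?M = 2"
      unfolding dim_submatrix cd using that(5) lu(1) by simp_all
    have sub: "?M $$ (k, z) = A $$ (pick {i, j} k, pick {l, u} z)" if "k < 2" "z < 2" for k z
      by (rule submatrix_index) (use that dim in \<open>simp_all add: dim_submatrix\<close>)
    have "?M $$ (0, x) = 1 \<and> ?M $$ (Suc 0, x) = 0 \<and> ?M $$ (0, y) = 0 \<and> ?M $$ (Suc 0, y) = 1"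
      using that(6-) xy
      by (simp add: sub pick pick_pair[OF that(5)] del: pick.simps)
    then have "row_col_permutation ?M I\<^sub>2"
      unfolding row_col_permutation_I2_iff using dim xy
      by (intro conjI exI[of _ 0] exI[of _ "Suc 0"] exI[of _ x] exI[of _ y]) simp_all
    then show False
      using av by (auto simp: avoids_def)
  qed
  show "I2_free (dim_row A) (set (cols A))"
    unfolding I2_free_def
  proof (intro ballI allI impI notI)
    fix c d i j assume cd: "c \<in> set (cols A)" "d \<in> set (cols A)" and ij: "i < dim_row A" "j < dim_row A"
      and e: "c $ i = 1 \<and> c $ j = 0 \<and> d $ i = 0 \<and> d $ j = 1"
    obtain a b where ab: "a < dim_col A" "b < dim_col A" "c = col A a" "d = col A b"
      using cd by (auto simp: cols_def)
    have "i \<noteq> j" using e by auto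
    then show False
      using no[of i j a b] no[of j i b a] ab ij e by (cases i j rule: linorder_cases) auto
  qed
qed

lemma r_matrix_iff: "r_matrix r A \<longleftrightarrow> set (cols A) \<subseteq> r_vecs (dim_row A) r"
proof -
  have "r_matrix r A \<longleftrightarrow> (\<forall>i<dim_row A. \<forall>j<dim_col A. A $$ (i, j) < r)"
    by (fastforce simp: r_matrix_def)
  then show ?thesis
    by (auto simp: r_vecs_def cols_def image_subset_iff)
qed

lemma avoiding_matrices_I2_iff:
  "A \<in> avoiding_matrices m r I\<^sub>2 \<longleftrightarrow> dim_row A = m \<and> distinct (cols A) \<and>
     set (cols A) \<subseteq> r_vecs m r \<and> I2_free m (set (cols A))"
  by (auto simp: avoiding_matrices_def r_matrix_iff simple_matrix_def avoids_I2_iff)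

text \<open>It suffices to match the column sets by permuting rows: two duplicate-free lists with
  the same set differ by a permutation, which supplies the column permutation.\<close>

lemma row_col_permutationI:
  assumes dim: "dim_row A = m" "dim_row B = m" and dist: "distinct (cols A)" "distinct (cols B)"
    and p: "p permutes {..<m}"
    and img: "(\<lambda>c. vec m (\<lambda>i. c $ p i)) ` set (cols B) = set (cols A)"
    and card: "dim_col B = dim_col A"
  shows "row_col_permutation B A"
proof -
  let ?f = "\<lambda>c. vec m (\<lambda>i. c $ p i)"
  \<comment> \<open>The image has \<open>dim_col A\<close> elements and the list has equally many
    entries, so no repetition is possible.\<close>
  have "distinct (map ?f (cols B))"
    using img card dist by (intro card_distinct) (simp add: distinct_card)
  then have "mset (map ?f (cols B)) = mset (cols A)"
    using img dist by (intro set_eq_iff_mset_eq_distinct[THEN iffD1]) simp_all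
  then obtain q where q: "q permutes {..<dim_col A}" "permute_list q (cols A) = map ?f (cols B)"
    by (metis cols_length mset_eq_permutation)
  have ent: "B $$ (p i, j) = A $$ (i, q j)" if "i < m" "j < dim_col A" for i j
  proof -
    have qj: "q j < dim_col A" using permutes_in_image[OF q(1)] that by simp
    have pi: "p i < m" using permutes_in_image[OF p] that by simp
    have "permute_list q (cols A) ! j $ i = map ?f (cols B) ! j $ i"
      using q(2) by simp
    then show ?thesis
      using that q(1) qj pi dim card by (simp add: permute_list_nth)
  qed
  \<comment> \<open>In \<open>ent\<close> the permutation acts on the rows of \<open>B\<close>, but
    \<open>row_col_permutation B A\<close> needs it on those of \<open>A\<close>.\<close>
  define p' where "p' = inv_into UNIV p"
  have p': "p' permutes {..<m}"
    unfolding p'_def by (rule permutes_inv[OF p])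
  have "B = mat (dim_row A) (dim_col A) (\<lambda>(i, j). A $$ (p' i, q j))"
  proof (rule eq_matI)
    fix i j assume "i < dim_row (mat (dim_row A) (dim_col A) (\<lambda>(i, j). A $$ (p' i, q j)))"
      and "j < dim_col (mat (dim_row A) (dim_col A) (\<lambda>(i, j). A $$ (p' i, q j)))"
    then have ij: "i < m" "j < dim_col A" using dim by auto
    then have "p' i < m" using permutes_in_image[OF p'] by simp
    then show "B $$ (i, j) = mat (dim_row A) (dim_col A) (\<lambda>(i, j). A $$ (p' i, q j)) $$ (i, j)"
      using ent[of "p' i" j] ij dim permutes_inverses(1)[OF p] by (simp add: p'_def)
  qed (use dim card in auto)
  then show ?thesis
    using p' q(1) dim card unfolding row_col_permutation_def by auto
qed

section \<open>The value of \<open>forb\<close> and the uniqueness of the extremal matrix\<close>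

theorem theorem4p3:
  fixes r m :: nat
  assumes "r \<ge> 2" and "m \<ge> 1"
  shows "\<exists>A \<in> avoiding_matrices m r I\<^sub>2. dim_col A = forb m r I\<^sub>2 \<and>
           (\<forall>B \<in> avoiding_matrices m r I\<^sub>2.
              dim_col B = forb m r I\<^sub>2 \<longrightarrow> row_col_permutation B A)"
proof -
  \<comment> \<open>Any listing of the sorted vectors serves as the columns of \<open>A\<close>,
    since columns may be permuted.\<close>
  obtain xs where xs: "set xs = sorted_vecs m r" "distinct xs"
    using finite_distinct_list[OF finite_sorted_vecs] by blast
  define A where "A = mat_of_cols m xs"
  have sub: "sorted_vecs m r \<subseteq> r_vecs m r" "r_vecs m r \<subseteq> carrier_vec m"
    by (auto simp: sorted_vecs_def r_vecs_def)
  then have cols: "cols A = xs"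
    unfolding A_def using xs by (intro cols_mat_of_cols) auto
  have A: "A \<in> avoiding_matrices m r I\<^sub>2"
    unfolding avoiding_matrices_I2_iff cols
    using xs sub I2_free_sorted_vecs by (simp add: A_def)
  have dimA: "dim_col A = card (sorted_vecs m r)"
    using xs by (metis cols cols_length distinct_card)
  have card_cols: "card (set (cols B)) = dim_col B" if "B \<in> avoiding_matrices m r I\<^sub>2" for B
    using that by (simp add: avoiding_matrices_I2_iff distinct_card)
  have le: "dim_col B \<le> card (sorted_vecs m r)" if "B \<in> avoiding_matrices m r I\<^sub>2" for B
    using card_I2_free_le[of m "set (cols B)" r] that assms(1) card_cols[OF that]
    by (simp add: avoiding_matrices_I2_iff)
  \<comment> \<open>The bound \<open>le\<close> gives both the finiteness that
    \<open>Max_eqI\<close> asks for and maximality; \<open>A\<close> attains it.\<close>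
  have forb: "forb m r I\<^sub>2 = card (sorted_vecs m r)"
    unfolding forb_def
  proof (rule Max_eqI)
    show "finite (dim_col ` avoiding_matrices m r I\<^sub>2)"
      by (rule finite_subset[of _ "{..card (sorted_vecs m r)}"]) (use le in auto)
  qed (use le A dimA in force)+
  have "row_col_permutation B A"
    if B: "B \<in> avoiding_matrices m r I\<^sub>2" "dim_col B = forb m r I\<^sub>2" for B
  proof -
    have "card (set (cols B)) = card (sorted_vecs m r)"
      using card_cols[OF B(1)] B(2) forb by simp
    then obtain p where "p permutes {..<m}"
      "(\<lambda>c. vec m (\<lambda>i. c $ p i)) ` set (cols B) = sorted_vecs m r"
      using B(1) assms(1) extremal_I2_free_sorted[of m "set (cols B)" r]
      unfolding avoiding_matrices_I2_iff by blast
    then show ?thesis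
      using A B dimA forb xs cols
      by (intro row_col_permutationI[of A m B p]) (auto simp: avoiding_matrices_I2_iff)
  qed
  then show ?thesis
    using A dimA forb by auto
qed

end
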